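(* Suppose that $0<\mu\leq M$ on $[0,1]$ for a constant $M$ and that $s$ is $C$-Lipschitz on $[0,1]$. Take $k=k_n$ such that $k+1=n^{1/3}$ up to rounding to an integer (i.e. $k$ is an integer with $|k+1-n^{1/3}|<1$). Then there is a positive constant $K$, not depending on $n$, such that the risk of a purely uniformly random tree (PURT) satisfies $$\mathbb{E}\big[(\hat{s}_{\mathbb{U}}(X)-s(X))^2\big]\leq K n^{-2/3}+o(n^{-2/3})\quad (n\to+\infty).$$
   Context: Model: $(X_1,Y_1),\dots,(X_n,Y_n)$ are i.i.d. copies of $(X,Y)$ (the learning sample $\mathcal{L}_n$), with $Y_i=s(X_i)+\varepsilon_i$, where $s:[0,1]\to\mathbb{R}$ is the (fixed, unknown) regression function, $X\in[0,1]$ has a continuous density $\mu$ on $[0,1]$, and $\varepsilon_1,\dots,\varepsilon_n$ are i.i.d. copies of a real random variable $\varepsilon$, independent of $(X_1,\dots,X_n)$, with $\mathbb{E}[\varepsilon]=0$ and $\mathrm{Var}(\varepsilon)=\sigma^2$. In risks, $X$ denotes a new point with density $\mu$, independent of $\mathcal{L}_n$ and of the random partition. Tree: for a natural integer $k$ (depending on $n$), $\mathbb{U}=(U_1,\dots,U_k)$ are i.i.d. uniform on $[0,1]$, independent of $\mathcal{L}_n$ and $X$; $U_{(1)}\leq\dots\leq U_{(k)}$ are their order statistics, $U_{(0)}=0$, $U_{(k+1)}=1$. The purely uniformly random tree (PURT) is the estimator, for $x\in[0,1]$, $$\hat{s}_{\mathbb{U}}(x)=\sum_{j=0}^k\hat\beta_j\mathbf{1}_{U_{(j)}<x\leq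 U_{(j+1)}},\qquad \hat\beta_j=\frac{1}{\#\{i:U_{(j)}<X_i\leq U_{(j+1)}\}}\sum_{i:\,U_{(j)}<X_i\leq U_{(j+1)}}Y_i,$$ with $\hat\beta_j=0$ if the cell $(U_{(j)},U_{(j+1)}]$ contains no $X_i$. *)

theory Defs
  imports "HOL-Probability.Probability" "HOL-Library.Landau_Symbols"
begin

text \<open>
  Order statistics of \<open>u 1, \<dots>, u k\<close>, extended by \<open>0\<close> at index \<open>0\<close> and by \<open>1\<close> at index \<open>k + 1\<close>.
\<close>
definition order_stat :: "nat \<Rightarrow> (nat \<Rightarrow> real) \<Rightarrow> nat \<Rightarrow> real" where
  "order_stat k u j = (0 # sort (map u [1..<Suc k]) @ [1]) ! j"

definition purt_cell :: "nat \<Rightarrow> (nat \<Rightarrow> real) \<Rightarrow> nat \<Rightarrow> real set" where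
  "purt_cell k u j = {order_stat k u j <.. order_stat k u (Suc j)}"

text \<open>On an empty cell the quotient is \<open>0 / 0 = 0\<close>, which is the intended convention.\<close>
definition cell_mean ::
  "nat \<Rightarrow> nat \<Rightarrow> (nat \<Rightarrow> real) \<Rightarrow> (nat \<Rightarrow> real) \<Rightarrow> (nat \<Rightarrow> real) \<Rightarrow> nat \<Rightarrow> real" where
  "cell_mean n k u x y j =
     (\<Sum>i\<in>{i\<in>{1..n}. x i \<in> purt_cell k u j}. y i) / real (card {i\<in>{1..n}. x i \<in> purt_cell k u j})"

definition purt ::
  "nat \<Rightarrow> nat \<Rightarrow> (nat \<Rightarrow> real) \<Rightarrow> (nat \<Rightarrow> real) \<Rightarrow> (nat \<Rightarrow> real) \<Rightarrow> real \<Rightarrow> real" where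
  "purt n k u x y t = (\<Sum>j=0..k. cell_mean n k u x y j * indicator (purt_cell k u j) t)"

text \<open>
  Index type of the elementary random variables: design points, noise variables, split points,
  and the new point at which the risk is evaluated.
\<close>
datatype source = Design nat | Noise nat | Split nat | New

text \<open>
  The model for one sample size \<open>n\<close> and one number of splits \<open>k\<close>; \<open>Z\<close> is the new point, and
  \<open>\<nu>\<close> is the common law of the noise variables. The regression function \<open>s\<close> and the density \<open>\<mu>\<close>
  are used on \<open>[0,1]\<close> only. Square integrability is stated separately because \<open>variance\<close> is
  \<open>0\<close> by convention when the integral does not exist.
\<close>
locale purt_model = prob_space P
  for P :: "'a measure" +
  fixes s :: "real \<Rightarrow> real"
    and \<mu> :: "real \<Rightarrow> real"
    and \<nu> :: "real measure"
    and \<sigma> :: real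
    and n k :: nat
    and X Y \<epsilon> U :: "nat \<Rightarrow> 'a \<Rightarrow> real"
    and Z :: "'a \<Rightarrow> real"
  assumes \<mu>_continuous: "continuous_on {0..1} \<mu>"
    and X_range: "\<And>i \<omega>. i \<in> {1..n} \<Longrightarrow> \<omega> \<in> space P \<Longrightarrow> X i \<omega> \<in> {0..1}"
    and X_density: "\<And>i. i \<in> {1..n} \<Longrightarrow>
          distributed P lborel (X i) (\<lambda>x. ennreal (\<mu> x * indicator {0..1} x))"
    and Z_range: "\<And>\<omega>. \<omega> \<in> space P \<Longrightarrow> Z \<omega> \<in> {0..1}"
    and Z_density: "distributed P lborel Z (\<lambda>x. ennreal (\<mu> x * indicator {0..1} x))"
    and noise_law: "\<And>i. i \<in> {1..n} \<Longrightarrow> distr P borel (\<epsilon> i) = \<nu>"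
    and noise_square_integrable: "\<And>i. i \<in> {1..n} \<Longrightarrow> integrable P (\<lambda>\<omega>. (\<epsilon> i \<omega>)\<^sup>2)"
    and noise_mean: "\<And>i. i \<in> {1..n} \<Longrightarrow> expectation (\<epsilon> i) = 0"
    and noise_variance: "\<And>i. i \<in> {1..n} \<Longrightarrow> variance (\<epsilon> i) = \<sigma>\<^sup>2"
    and response: "\<And>i \<omega>. i \<in> {1..n} \<Longrightarrow> \<omega> \<in> space P \<Longrightarrow> Y i \<omega> = s (X i \<omega>) + \<epsilon> i \<omega>"
    and U_uniform: "\<And>j. j \<in> {1..k} \<Longrightarrow> distr P borel (U j) = uniform_measure lborel {0..1}"
    and independent: "indep_vars (\<lambda>_. borel) (case_source X \<epsilon> U Z)
          (Design ` {1..n} \<union> Noise ` {1..n} \<union> Split ` {1..k} \<union> {New})"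

definition purt_sq_error ::
  "(real \<Rightarrow> real) \<Rightarrow> nat \<Rightarrow> nat \<Rightarrow> (nat \<Rightarrow> 'a \<Rightarrow> real) \<Rightarrow> (nat \<Rightarrow> 'a \<Rightarrow> real) \<Rightarrow> (nat \<Rightarrow> 'a \<Rightarrow> real)
     \<Rightarrow> ('a \<Rightarrow> real) \<Rightarrow> 'a \<Rightarrow> real" where
  "purt_sq_error s n k X Y U Z \<omega> =
     (purt n k (\<lambda>j. U j \<omega>) (\<lambda>i. X i \<omega>) (\<lambda>i. Y i \<omega>) (Z \<omega>) - s (Z \<omega>))\<^sup>2"

end

theory Submission
  imports Defs
begin

text \<open>
  The error at the new point splits into a bias, a noise average and, when the cell of the new point
  contains no design point, the value of the regression function itself (\<open>purt_sq_error_le\<close>).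

  Bias. By the Lipschitz condition it is at most \<open>C\<close> times the distance from the new point \<open>z\<close> to the
  ends of its cell. A point \<open>v\<close> lies in the cell of \<open>z\<close> iff no split separates the two, which
  has probability \<open>(1 - \<bar>v - z\<bar>)\<^sup>k\<close>; integrating this against \<open>2 \<bar>v - z\<bar>\<close> over \<open>v\<close> bounds the expected
  squared distance by \<open>4 / ((k + 1) (k + 2))\<close> (\<open>nn_integral_spread_le\<close>, \<open>expectation_spread_le\<close>).

  Noise and empty cells. Let \<open>N\<close> be the number of design points in the cell of the new point. Noise
  is centred and independent of the averaging weights, so it contributes \<open>\<sigma>\<^sup>2\<close> times the expectation
  of \<open>1 / N\<close> on \<open>N > 0\<close>; both this and the probability of \<open>N = 0\<close> are controlled by the expectation of
  \<open>1 / (N + 1)\<close>. Now \<open>N + 1\<close> is the occupancy of the own cell of one of \<open>n + 1\<close> exchangeable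
  points, and the inverse occupancies of the own cells add up to the number of occupied cells. Hence
  the expectation is at most \<open>(k + 1) / (n + 1)\<close> (\<open>expectation_inverse_count_le\<close>), without any
  computation with binomial laws.

  The risk is therefore of order \<open>1 / (k + 1)\<^sup>2 + (k + 1) / n\<close> (\<open>purt_risk_le\<close>), and both terms
  have order \<open>n powr (-2/3)\<close> when \<open>k + 1\<close> is about \<open>n powr (1/3)\<close>.
\<close>

section \<open>Cells as level sets of a counting function\<close>

definition splits_below :: "nat \<Rightarrow> (nat \<Rightarrow> real) \<Rightarrow> real \<Rightarrow> nat" where
  "splits_below k u x = card {j\<in>{1..k}. u j < x}"

definition cell_mates :: "nat \<Rightarrow> nat \<Rightarrow> (nat \<Rightarrow> real) \<Rightarrow> (nat \<Rightarrow> real) \<Rightarrow> real \<Rightarrow> nat set" where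
  "cell_mates n k u x z = {i\<in>{1..n}. splits_below k u (x i) = splits_below k u z}"

lemma splits_below_cong:
  "(\<And>j. j \<in> {1..k} \<Longrightarrow> u j = u' j) \<Longrightarrow> splits_below k u x = splits_below k u' x"
  unfolding splits_below_def by (intro arg_cong[of _ _ card]) auto

lemma splits_below_le: "splits_below k u x \<le> k"
proof -
  have "splits_below k u x \<le> card {1..k}"
    unfolding splits_below_def by (intro card_mono) auto
  then show ?thesis by simp
qed

lemma sorted_nth_less_iff:
  fixes xs :: "'a::linorder list"
  assumes "sorted xs" "i < length xs"
  shows "xs ! i < x \<longleftrightarrow> i < length (filter (\<lambda>y. y < x) xs)"
  using assms
proof (induction xs arbitrary: i)
  case (Cons a xs)
  show ?case
  proof (cases "a < x")
    case True
    then show ?thesis using Cons by (cases i) auto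
  next
    case False
    then have "\<not> y < x" if "y \<in> set (a # xs)" for y
      using Cons.prems(1) that by auto
    moreover have "(a # xs) ! i \<in> set (a # xs)"
      using Cons.prems(2) nth_mem by blast
    ultimately show ?thesis by (metis filter_False list.size(3) not_less_zero)
  qed
qed simp

text \<open>
  The sorted list is only ever inspected through comparisons with a threshold, and the number of its entries
  below a threshold does not depend on the order. This is what removes sorting from the rest of the argument
  and also makes order statistics measurable.
\<close>

lemma order_stat_less_iff:
  assumes "1 \<le> j" "j \<le> k"
  shows "order_stat k u j < x \<longleftrightarrow> j \<le> splits_below k u x"
proof -
  let ?ys = "map u [1..<Suc k]"
  have "length (filter (\<lambda>y. y < x) (sort ?ys)) = length (filter (\<lambda>y. y < x) ?ys)"
    by (simp only: filter_sort length_sort)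
  also have "\<dots> = length (filter (\<lambda>j. u j < x) [1..<Suc k])"
    by (simp add: filter_map comp_def del: upt_Suc)
  also have "\<dots> = card (set (filter (\<lambda>j. u j < x) [1..<Suc k]))"
    by (intro distinct_card[symmetric]) (simp del: upt_Suc)
  also have "set (filter (\<lambda>j. u j < x) [1..<Suc k]) = {j\<in>{1..k}. u j < x}"
    by (auto simp del: upt_Suc)
  finally have len: "length (filter (\<lambda>y. y < x) (sort ?ys)) = splits_below k u x"
    by (simp only: splits_below_def)
  have "order_stat k u j = sort ?ys ! (j - 1)"
    using assms by (cases j) (auto simp: order_stat_def nth_append simp del: upt_Suc)
  then show ?thesis
    using sorted_nth_less_iff[of "sort ?ys" "j - 1" x] assms len
    by (auto simp del: upt_Suc)
qed

text \<open>
  For any real splits, even ones outside \<open>[0,1]\<close>, a point of \<open>(0,1]\<close> lies in exactly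
  one cell, indexed by the number of splits below it. The left end point is excluded since the cells are open
  on the left.
\<close>

lemma mem_purt_cell_iff:
  assumes "x \<in> {0<..1}" "j \<le> k"
  shows "x \<in> purt_cell k u j \<longleftrightarrow> j = splits_below k u x"
proof -
  have less_iff: "order_stat k u i < x \<longleftrightarrow> i \<le> splits_below k u x" if "i \<le> Suc k" for i
  proof -
    consider "i = 0" | "1 \<le> i" "i \<le> k" | "i = Suc k" using \<open>i \<le> Suc k\<close> by linarith
    then show ?thesis
    proof cases
      case 1
      then show ?thesis using assms by (simp add: order_stat_def)
    next
      case 2
      then show ?thesis by (rule order_stat_less_iff)
    next
      case 3
      then show ?thesis using assms splits_below_le[of k u x]
        by (auto simp: order_stat_def nth_append simp del: upt_Suc)
    qed
  qed
  show ?thesis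
    using less_iff[of j] less_iff[of "Suc j"] assms by (auto simp: purt_cell_def not_less)
qed

lemma purt_eq_mean_of_cell_mates:
  assumes "\<And>i. i \<in> {1..n} \<Longrightarrow> x i \<in> {0<..1}" "z \<in> {0<..1}"
  shows "purt n k u x y z = (\<Sum>i\<in>cell_mates n k u x z. y i) / real (card (cell_mates n k u x z))"
proof -
  let ?c = "splits_below k u z"
  have mates: "{i\<in>{1..n}. x i \<in> purt_cell k u ?c} = cell_mates n k u x z"
    unfolding cell_mates_def using assms(1) mem_purt_cell_iff[OF _ splits_below_le] by auto
  have "purt n k u x y z = (\<Sum>j=0..k. if j = ?c then cell_mean n k u x y ?c else 0)"
    unfolding purt_def
    by (intro sum.cong) (auto simp: indicator_def mem_purt_cell_iff[OF assms(2)])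
  also have "\<dots> = cell_mean n k u x y ?c"
    using splits_below_le[of k u z] by simp
  finally show ?thesis by (simp only: cell_mean_def mates)
qed

text \<open>
  Counts of nested sets agree only if the sets do. In this form the relation of lying in the same cell is a
  finite conjunction of conditions on single splits, so it is visibly measurable and its probability
  factorizes.
\<close>

lemma splits_below_eq_iff:
  "splits_below k u x = splits_below k u z \<longleftrightarrow> (\<forall>j\<in>{1..k}. u j < x \<longleftrightarrow> u j < z)"
proof (induction x z rule: linorder_wlog)
  case (le x z)
  have sub: "{j\<in>{1..k}. u j < x} \<subseteq> {j\<in>{1..k}. u j < z}" using le by auto
  show ?case
  proof
    assume "splits_below k u x = splits_below k u z"
    then have "{j\<in>{1..k}. u j < x} = {j\<in>{1..k}. u j < z}"
      unfolding splits_below_def using sub by (intro card_subset_eq) auto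
    then show "\<forall>j\<in>{1..k}. u j < x \<longleftrightarrow> u j < z" by blast
  qed (auto simp: splits_below_def intro!: arg_cong[of _ _ card])
qed (metis (no_types, lifting))

lemma real_card_filter:
  assumes "finite A"
  shows "real (card {a\<in>A. Q a}) = (\<Sum>a\<in>A. if Q a then 1 else 0)"
  using assms by (simp add: sum.If_cases Int_def)

lemma measurable_same_cell:
  assumes [measurable]: "\<And>j. j \<in> {1..k} \<Longrightarrow> (\<lambda>\<omega>. u \<omega> j) \<in> borel_measurable N"
    "f \<in> borel_measurable N" "g \<in> borel_measurable N"
  shows "Measurable.pred N (\<lambda>\<omega>. splits_below k (u \<omega>) (f \<omega>) = splits_below k (u \<omega>) (g \<omega>))"
  unfolding splits_below_eq_iff by measurable

section \<open>The length of a cell\<close>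

text \<open>
  A measurable substitute for the squared diameter of the cell of \<open>z\<close>. For \<open>z\<close>
  splitting its cell into lengths \<open>L\<close> and \<open>R\<close> the value is
  \<open>L\<^sup>2 + R\<^sup>2\<close>; the integral form lets the expectation over the splits be computed by
  exchanging integrals, with the law of \<open>L\<close> and \<open>R\<close> never appearing.
\<close>

definition spread :: "nat \<Rightarrow> (nat \<Rightarrow> real) \<Rightarrow> real \<Rightarrow> ennreal" where
  "spread k u z = (\<integral>\<^sup>+v. ennreal (2 * \<bar>v - z\<bar>) *
     indicator {v\<in>{0..1}. splits_below k u v = splits_below k u z} v \<partial>lborel)"

text \<open>
  Cells are intervals, so all points between \<open>x\<close> and \<open>z\<close> contribute to the integral,
  and \<open>2 \<bar>v - z\<bar>\<close> integrates to \<open>(x - z)\<^sup>2\<close> over them.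
\<close>

lemma square_dist_le_spread:
  assumes "x \<in> {0..1}" "z \<in> {0..1}" "splits_below k u x = splits_below k u z"
  shows "ennreal ((x - z)\<^sup>2) \<le> spread k u z"
proof -
  define a b where "a = min x z" and "b = max x z"
  have "ennreal ((x - z)\<^sup>2) = (\<integral>\<^sup>+v. ennreal (2 * \<bar>v - z\<bar>) * indicator {a..b} v \<partial>lborel)"
  proof (cases "x \<le> z")
    case True
    have "(\<integral>\<^sup>+v. ennreal (2 * (z - v)) * indicator {x..z} v \<partial>lborel) = ennreal (- (z - z)\<^sup>2 - (- (z - x)\<^sup>2))"
      using True by (intro nn_integral_FTC_Icc) (auto intro!: derivative_eq_intros)
    moreover have "(\<integral>\<^sup>+v. ennreal (2 * (z - v)) * indicator {x..z} v \<partial>lborel)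
      = (\<integral>\<^sup>+v. ennreal (2 * \<bar>v - z\<bar>) * indicator {a..b} v \<partial>lborel)"
      using True by (intro nn_integral_cong) (auto simp: a_def b_def indicator_def)
    ultimately show ?thesis by (simp add: power2_commute)
  next
    case False
    have "(\<integral>\<^sup>+v. ennreal (2 * (v - z)) * indicator {z..x} v \<partial>lborel) = ennreal ((x - z)\<^sup>2 - (z - z)\<^sup>2)"
      using False by (intro nn_integral_FTC_Icc) (auto intro!: derivative_eq_intros)
    moreover have "(\<integral>\<^sup>+v. ennreal (2 * (v - z)) * indicator {z..x} v \<partial>lborel)
      = (\<integral>\<^sup>+v. ennreal (2 * \<bar>v - z\<bar>) * indicator {a..b} v \<partial>lborel)"
      using False by (intro nn_integral_cong) (auto simp: a_def b_def indicator_def)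
    ultimately show ?thesis by simp
  qed
  also have "\<dots> \<le> spread k u z"
    unfolding spread_def
  proof (intro nn_integral_mono mult_left_mono)
    fix v
    have "splits_below k u v = splits_below k u z" if "v \<in> {a..b}"
      unfolding splits_below_eq_iff
    proof
      fix j assume "j \<in> {1..k}"
      then have "u j < x \<longleftrightarrow> u j < z" using assms(3) unfolding splits_below_eq_iff by blast
      then show "u j < v \<longleftrightarrow> u j < z" using that unfolding a_def b_def by auto
    qed
    then show "(indicator {a..b} v :: ennreal) \<le> indicator {v\<in>{0..1}. splits_below k u v = splits_below k u z} v"
      using assms(1,2) by (auto simp: indicator_def a_def b_def)
  qed simp
  finally show ?thesis .
qed

text \<open>
  Each of the two sides of \<open>z\<close> contributes at most
  \<open>\<integral>\<^sub>0\<^sup>1 2 t (1 - t)\<^sup>k dt = 2 / ((k + 1) (k + 2))\<close>.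
\<close>

lemma nn_integral_tent_le:
  assumes "z \<in> {0..1}"
  shows "(\<integral>\<^sup>+v. ennreal (2 * \<bar>v - z\<bar> * (1 - \<bar>v - z\<bar>) ^ k) * indicator {0..1} v \<partial>lborel)
    \<le> ennreal (4 / ((real k + 1) * (real k + 2)))"
proof -
  define c where "c = (real k + 1) * (real k + 2)"
  have c: "c > 0" unfolding c_def by simp
  \<comment> \<open>The antiderivative of \<open>2 t (1 - t)\<^sup>k\<close> that integration by parts gives.\<close>
  define G where "G t = - 2 * t * (1 - t) ^ Suc k / (real k + 1) - 2 * (1 - t) ^ (k + 2) / c" for t :: real
  have G: "(G has_real_derivative 2 * t * (1 - t) ^ k) (at t)" for t
    unfolding G_def c_def
    apply (rule derivative_eq_intros refl | simp)+
    apply (simp add: divide_simps)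
    apply (simp add: algebra_simps)
    done
  have G0: "G 0 = - 2 / c" by (simp add: G_def)
  have Gle: "G t \<le> 0" if "t \<in> {0..1}" for t
  proof -
    have "0 \<le> 2 * t * (1 - t) ^ Suc k / (real k + 1)" "0 \<le> 2 * (1 - t) ^ (k + 2) / c"
      using that c by (auto intro!: divide_nonneg_pos mult_nonneg_nonneg zero_le_power)
    then show ?thesis unfolding G_def by simp
  qed
  have half_le: "(\<integral>\<^sup>+t. ennreal (2 * t * (1 - t) ^ k) * indicator {0..b} t \<partial>lborel) \<le> ennreal (2 / c)"
    if "b \<in> {0..1}" for b
  proof -
    have "(\<integral>\<^sup>+t. ennreal (2 * t * (1 - t) ^ k) * indicator {0..b} t \<partial>lborel) = ennreal (G b - G 0)"
      using that by (intro nn_integral_FTC_Icc) (auto intro!: G[THEN DERIV_subset] mult_nonneg_nonneg)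
    also have "\<dots> \<le> ennreal (2 / c)"
      using Gle[OF that] G0 by (intro ennreal_leI) simp
    finally show ?thesis .
  qed
  let ?f = "\<lambda>t. ennreal (2 * t * (1 - t) ^ k)"
  have right: "(\<integral>\<^sup>+v. ?f (v - z) * indicator {z..1} v \<partial>lborel) \<le> ennreal (2 / c)"
  proof -
    have "(\<integral>\<^sup>+v. ?f (v - z) * indicator {z..1} v \<partial>lborel)
        = (\<integral>\<^sup>+t. ?f (z + 1 * t - z) * indicator {z..1} (z + 1 * t) \<partial>lborel)"
      by (subst nn_integral_real_affine[where c=1 and t=z]) auto
    also have "\<dots> = (\<integral>\<^sup>+t. ?f t * indicator {0..1 - z} t \<partial>lborel)"
      by (intro nn_integral_cong) (auto simp: indicator_def)
    also have "\<dots> \<le> ennreal (2 / c)" using assms by (intro half_le) auto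
    finally show ?thesis .
  qed
  have left: "(\<integral>\<^sup>+v. ?f (z - v) * indicator {0..z} v \<partial>lborel) \<le> ennreal (2 / c)"
  proof -
    have "(\<integral>\<^sup>+v. ?f (z - v) * indicator {0..z} v \<partial>lborel)
        = (\<integral>\<^sup>+t. ?f (z - (z + -1 * t)) * indicator {0..z} (z + -1 * t) \<partial>lborel)"
      by (subst nn_integral_real_affine[where c="-1" and t=z]) auto
    also have "\<dots> = (\<integral>\<^sup>+t. ?f t * indicator {0..z} t \<partial>lborel)"
      by (intro nn_integral_cong) (auto simp: indicator_def)
    also have "\<dots> \<le> ennreal (2 / c)" using assms by (intro half_le) auto
    finally show ?thesis .
  qed
  have "(\<integral>\<^sup>+v. ?f \<bar>v - z\<bar> * indicator {0..1} v \<partial>lborel)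
      \<le> (\<integral>\<^sup>+v. ?f (v - z) * indicator {z..1} v + ?f (z - v) * indicator {0..z} v \<partial>lborel)"
  proof (intro nn_integral_mono)
    fix v
    show "?f \<bar>v - z\<bar> * indicator {0..1} v
        \<le> ?f (v - z) * indicator {z..1} v + ?f (z - v) * indicator {0..z} v"
      using assms by (cases "v \<le> z") (auto simp: indicator_def abs_if)
  qed
  also have "\<dots> \<le> ennreal (2 / c) + ennreal (2 / c)"
    using left right by (subst nn_integral_add) (auto intro!: add_mono)
  also have "\<dots> = ennreal (4 / c)"
    using c by (subst ennreal_plus[symmetric]) (auto simp: field_simps)
  finally show ?thesis by (simp only: c_def)
qed

lemma prob_split_outside:
  assumes "0 \<le> a" "a \<le> b" "b \<le> 1"
  shows "emeasure (uniform_measure lborel {0..1}) (- {a..<b::real}) = ennreal (1 - (b - a))"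
proof -
  have "emeasure (uniform_measure lborel {0..1}) (- {a..<b}) = emeasure lborel ({0..1} \<inter> - {a..<b})"
    by (simp add: emeasure_uniform_measure divide_ennreal_def)
  also have "{0..1} \<inter> - {a..<b} = {0..<a} \<union> {b..1}" using assms by auto
  also have "emeasure lborel \<dots> = emeasure lborel {0..<a} + emeasure lborel {b..1}"
    using assms by (intro plus_emeasure[symmetric]) auto
  also have "\<dots> = ennreal (1 - (b - a))"
    using assms by (simp add: ennreal_plus[symmetric] del: ennreal_plus)
  finally show ?thesis .
qed

text \<open>
  Two points share a cell iff none of the independent splits separates them.
\<close>

lemma prob_same_cell:
  assumes "v \<in> {0..1}" "z \<in> {0..1}"
  shows "(\<integral>\<^sup>+u. indicator {u. splits_below k u v = splits_below k u z} u
           \<partial>(\<Pi>\<^sub>M j\<in>{1..k}. uniform_measure lborel {0..1})) = ennreal ((1 - \<bar>v - z\<bar>) ^ k)"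
proof -
  let ?Q = "uniform_measure lborel {0..1::real}"
  define a b where "a = min v z" and "b = max v z"
  have ab: "0 \<le> a" "a \<le> b" "b \<le> 1" "b - a = \<bar>v - z\<bar>" using assms by (auto simp: a_def b_def)
  interpret Q: prob_space ?Q by (intro prob_space_uniform_measure) auto
  interpret product_sigma_finite "\<lambda>_::nat. ?Q" by standard
  have "(\<integral>\<^sup>+u. indicator {u. splits_below k u v = splits_below k u z} u \<partial>(\<Pi>\<^sub>M j\<in>{1..k}. ?Q))
      = (\<integral>\<^sup>+u. (\<Prod>j\<in>{1..k}. indicator (- {a..<b}) (u j)) \<partial>(\<Pi>\<^sub>M j\<in>{1..k}. ?Q))"
  proof (intro nn_integral_cong)
    fix u :: "nat \<Rightarrow> real"
    have "(u j < v \<longleftrightarrow> u j < z) \<longleftrightarrow> u j \<in> - {a..<b}" for j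
      by (auto simp: a_def b_def)
    then have "(indicator {u. splits_below k u v = splits_below k u z} u :: ennreal)
        = of_bool (\<forall>j\<in>{1..k}. u j \<in> - {a..<b})"
      unfolding splits_below_eq_iff by (simp add: indicator_def)
    also have "\<dots> = (\<Prod>j\<in>{1..k}. indicator (- {a..<b}) (u j))"
      by (auto simp: indicator_def prod_zero_iff)
    finally show "(indicator {u. splits_below k u v = splits_below k u z} u :: ennreal)
        = (\<Prod>j\<in>{1..k}. indicator (- {a..<b}) (u j))" .
  qed
  also have "\<dots> = (\<Prod>j\<in>{1..k}. \<integral>\<^sup>+x. indicator (- {a..<b}) x \<partial>?Q)"
    by (intro product_nn_integral_prod) auto
  also have "\<dots> = ennreal ((1 - \<bar>v - z\<bar>) ^ k)"
    using ab prob_split_outside[of a b] assms by (simp add: ennreal_power)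
  finally show ?thesis .
qed

text \<open>
  Exchange the two integrals, so that the inner one becomes the probability that \<open>v\<close> and
  \<open>z\<close> share a cell.
\<close>

lemma nn_integral_spread_le:
  assumes "z \<in> {0..1}"
  shows "(\<integral>\<^sup>+u. spread k u z \<partial>(\<Pi>\<^sub>M j\<in>{1..k}. uniform_measure lborel {0..1}))
    \<le> ennreal (4 / ((real k + 1) * (real k + 2)))"
proof -
  let ?Q = "uniform_measure lborel {0..1::real}"
  let ?QQ = "\<Pi>\<^sub>M j\<in>{1..k}. ?Q"
  let ?S = "\<lambda>u v. splits_below k u v = splits_below k u z"
  interpret Q: prob_space ?Q by (intro prob_space_uniform_measure) auto
  interpret product_sigma_finite "\<lambda>_::nat. ?Q" by standard
  interpret QQ: prob_space ?QQ by (intro prob_space_PiM) unfold_locales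
  interpret pair_sigma_finite ?QQ lborel by standard
  have [measurable]: "Measurable.pred (?QQ \<Otimes>\<^sub>M lborel) (\<lambda>(u, v). ?S u v)"
    unfolding split_beta by (intro measurable_same_cell) measurable
  have [measurable]: "Measurable.pred ?QQ (\<lambda>u. ?S u v)" for v
    by (intro measurable_same_cell) measurable
  have [measurable]: "(\<lambda>u. indicator {u. ?S u v} u :: ennreal) \<in> borel_measurable ?QQ" for v
    by measurable
  have "(\<integral>\<^sup>+u. spread k u z \<partial>?QQ)
    = (\<integral>\<^sup>+u. \<integral>\<^sup>+v. ennreal (2 * \<bar>v - z\<bar>) * indicator {0..1} v * indicator {(u, v). ?S u v} (u, v) \<partial>lborel \<partial>?QQ)"
    unfolding spread_def by (intro nn_integral_cong) (auto simp: indicator_def)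
  also have "\<dots> = (\<integral>\<^sup>+v. \<integral>\<^sup>+u. ennreal (2 * \<bar>v - z\<bar>) * indicator {0..1} v * indicator {(u, v). ?S u v} (u, v) \<partial>?QQ \<partial>lborel)"
    by (rule Fubini'[symmetric]) measurable
  also have "\<dots> = (\<integral>\<^sup>+v. ennreal (2 * \<bar>v - z\<bar>) * indicator {0..1} v * (\<integral>\<^sup>+u. indicator {u. ?S u v} u \<partial>?QQ) \<partial>lborel)"
  proof (intro nn_integral_cong)
    fix v :: real
    have "(\<integral>\<^sup>+u. ennreal (2 * \<bar>v - z\<bar>) * indicator {0..1} v * indicator {(u, v). ?S u v} (u, v) \<partial>?QQ)
        = (\<integral>\<^sup>+u. ennreal (2 * \<bar>v - z\<bar>) * indicator {0..1} v * indicator {u. ?S u v} u \<partial>?QQ)"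
      by (intro nn_integral_cong) (auto simp: indicator_def)
    also have "\<dots> = ennreal (2 * \<bar>v - z\<bar>) * indicator {0..1} v * (\<integral>\<^sup>+u. indicator {u. ?S u v} u \<partial>?QQ)"
      by (rule nn_integral_cmult) measurable
    finally show "(\<integral>\<^sup>+u. ennreal (2 * \<bar>v - z\<bar>) * indicator {0..1} v * indicator {(u, v). ?S u v} (u, v) \<partial>?QQ) = \<dots>" .
  qed
  also have "\<dots> = (\<integral>\<^sup>+v. ennreal (2 * \<bar>v - z\<bar> * (1 - \<bar>v - z\<bar>) ^ k) * indicator {0..1} v \<partial>lborel)"
  proof (intro nn_integral_cong)
    fix v :: real
    show "ennreal (2 * \<bar>v - z\<bar>) * indicator {0..1} v * (\<integral>\<^sup>+u. indicator {u. ?S u v} u \<partial>?QQ)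
        = ennreal (2 * \<bar>v - z\<bar> * (1 - \<bar>v - z\<bar>) ^ k) * indicator {0..1} v"
    proof (cases "v \<in> {0..1}")
      case True
      then have "0 \<le> 1 - \<bar>v - z\<bar>" using assms by auto
      then show ?thesis using prob_same_cell[OF True assms, of k] True
        by (simp add: ennreal_mult)
    qed simp
  qed
  also have "\<dots> \<le> ennreal (4 / ((real k + 1) * (real k + 2)))"
    using assms by (rule nn_integral_tent_le)
  finally show ?thesis .
qed

lemma measurable_spread:
  assumes "\<And>j. j \<in> {1..k} \<Longrightarrow> (\<lambda>\<omega>. u \<omega> j) \<in> borel_measurable N" "z \<in> borel_measurable N"
  shows "(\<lambda>\<omega>. spread k (u \<omega>) (z \<omega>)) \<in> borel_measurable N"
proof -
  note [measurable] = assms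
  have [measurable]: "Measurable.pred (N \<Otimes>\<^sub>M lborel)
      (\<lambda>p. splits_below k (u (fst p)) (snd p) = splits_below k (u (fst p)) (z (fst p)))"
    by (intro measurable_same_cell) measurable
  show ?thesis
    unfolding spread_def
    by (intro lborel.borel_measurable_nn_integral) (auto simp: split_beta')
qed

lemma spread_finite: "z \<in> {0..1} \<Longrightarrow> spread k u z < \<infinity>"
proof -
  assume z: "z \<in> {0..1}"
  have "spread k u z \<le> (\<integral>\<^sup>+v. 2 * indicator {0..1::real} v \<partial>lborel)"
    unfolding spread_def
  proof (intro nn_integral_mono)
    fix v :: real
    have "ennreal (2 * \<bar>v - z\<bar>) \<le> ennreal 2" if "v \<in> {0..1}"
      using that z by (intro ennreal_leI) auto
    then show "ennreal (2 * \<bar>v - z\<bar>) * indicator {v\<in>{0..1}. splits_below k u v = splits_below k u z} v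
      \<le> 2 * indicator {0..1} v"
      by (auto simp: indicator_def)
  qed
  also have "\<dots> < \<infinity>" by (simp add: nn_integral_cmult)
  finally show ?thesis .
qed

section \<open>Averaging over the points of a cell\<close>

lemma sum_inverse_card_fibre:
  assumes "finite J"
  shows "(\<Sum>b\<in>J. 1 / real (card {a\<in>J. c a = c b})) = real (card (c ` J))"
proof -
  have "(\<Sum>b\<in>J. 1 / real (card {a\<in>J. c a = c b}))
      = (\<Sum>y\<in>c ` J. \<Sum>b\<in>{a\<in>J. c a = y}. 1 / real (card {a\<in>J. c a = c b}))"
    using assms by (rule sum.image_gen)
  also have "\<dots> = (\<Sum>y\<in>c ` J. 1)"
  proof (intro sum.cong refl)
    fix y assume "y \<in> c ` J"
    then have "card {a\<in>J. c a = y} \<noteq> 0" using assms by auto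
    then show "(\<Sum>b\<in>{a\<in>J. c a = y}. 1 / real (card {a\<in>J. c a = c b})) = 1" by simp
  qed
  finally show ?thesis by simp
qed

lemma measurable_card_cell_mates:
  assumes "\<And>j. j \<in> {1..k} \<Longrightarrow> (\<lambda>\<omega>. u \<omega> j) \<in> borel_measurable N"
    and [measurable]: "\<And>i. i \<in> {1..n} \<Longrightarrow> (\<lambda>\<omega>. x \<omega> i) \<in> borel_measurable N"
    and [measurable]: "z \<in> borel_measurable N"
  shows "(\<lambda>\<omega>. real (card (cell_mates n k (u \<omega>) (x \<omega>) (z \<omega>)))) \<in> borel_measurable N"
proof -
  have [measurable]: "Measurable.pred N (\<lambda>\<omega>. splits_below k (u \<omega>) (x \<omega> i) = splits_below k (u \<omega>) (z \<omega>))"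
    if "i \<in> {1..n}" for i
    using that assms by (intro measurable_same_cell) auto
  show ?thesis
    unfolding cell_mates_def by (subst real_card_filter) measurable
qed

text \<open>
  For points of \<open>(0,1]\<close>, the estimator at \<open>z\<close> is the average of the responses with
  these weights.
\<close>

definition mate_weight :: "nat \<Rightarrow> nat \<Rightarrow> (nat \<Rightarrow> real) \<Rightarrow> (nat \<Rightarrow> real) \<Rightarrow> real \<Rightarrow> nat \<Rightarrow> real" where
  "mate_weight n k u x z i = of_bool (i \<in> cell_mates n k u x z) / real (card (cell_mates n k u x z))"

lemma measurable_mate_weight:
  assumes "\<And>j. j \<in> {1..k} \<Longrightarrow> (\<lambda>\<omega>. u \<omega> j) \<in> borel_measurable N"
    and "\<And>i. i \<in> {1..n} \<Longrightarrow> (\<lambda>\<omega>. x \<omega> i) \<in> borel_measurable N"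
    and "z \<in> borel_measurable N" and i: "i \<in> {1..n}"
  shows "(\<lambda>\<omega>. mate_weight n k (u \<omega>) (x \<omega>) (z \<omega>) i) \<in> borel_measurable N"
proof -
  have [measurable]: "Measurable.pred N (\<lambda>\<omega>. splits_below k (u \<omega>) (x \<omega> i) = splits_below k (u \<omega>) (z \<omega>))"
    using assms by (intro measurable_same_cell) auto
  note [measurable] = measurable_card_cell_mates[OF assms(1-3)]
  have "(\<lambda>\<omega>. mate_weight n k (u \<omega>) (x \<omega>) (z \<omega>) i) = (\<lambda>\<omega>.
      (if splits_below k (u \<omega>) (x \<omega> i) = splits_below k (u \<omega>) (z \<omega>) then 1 else 0)
        / real (card (cell_mates n k (u \<omega>) (x \<omega>) (z \<omega>))))"
    unfolding mate_weight_def using i by (auto simp: cell_mates_def fun_eq_iff)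
  also have "\<dots> \<in> borel_measurable N" by measurable
  finally show ?thesis .
qed

lemma finite_cell_mates [simp]: "finite (cell_mates n k u x z)"
  unfolding cell_mates_def by simp

lemma mate_weight_nonneg: "0 \<le> mate_weight n k u x z i"
  and mate_weight_le_1: "mate_weight n k u x z i \<le> 1"
proof -
  let ?m = "card (cell_mates n k u x z)"
  show "0 \<le> mate_weight n k u x z i" by (simp add: mate_weight_def)
  have "1 / real m \<le> 1" for m :: nat by (cases m) auto
  from this[of ?m] show "mate_weight n k u x z i \<le> 1"
    by (cases "i \<in> cell_mates n k u x z") (auto simp only: mate_weight_def of_bool_eq div_0 zero_le_one)
qed

text \<open>
  With \<open>m\<close> points in the cell the left side is \<open>1 / m\<close>, or \<open>0\<close> if the
  cell is empty. The right side is written with \<open>m + 1\<close>, the number of points once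
  \<open>z\<close> itself is counted, because this is the quantity on which exchangeability acts.
\<close>

lemma sum_mate_weight_square_le:
  "(\<Sum>i=1..n. (mate_weight n k u x z i)\<^sup>2) \<le> 2 / (real (card (cell_mates n k u x z)) + 1)"
proof -
  let ?S = "cell_mates n k u x z" and ?m = "real (card (cell_mates n k u x z))"
  have sub: "?S \<subseteq> {1..n}" by (auto simp: cell_mates_def)
  have "(\<Sum>i=1..n. (mate_weight n k u x z i)\<^sup>2) = (\<Sum>i\<in>?S. (1 / ?m)\<^sup>2)"
    using sub by (intro sum.mono_neutral_cong_right) (auto simp: mate_weight_def)
  also have "\<dots> = ?m * (1 / ?m)\<^sup>2" by simp
  also have "\<dots> \<le> 2 / (?m + 1)"
  proof -
    have "real m * (1 / real m)\<^sup>2 \<le> 2 / (real m + 1)" for m :: nat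
      by (cases m) (auto simp: power2_eq_square divide_simps)
    then show ?thesis .
  qed
  finally show ?thesis .
qed

section \<open>The error for given data\<close>

text \<open>
  The three terms are squared bias, noise and the error \<open>s(z)\<^sup>2\<close> made on an empty cell. The
  last is bounded through \<open>1 / (m + 1)\<close>, which equals \<open>1\<close> when \<open>m = 0\<close>,
  so that empty cells need no estimate of their own.
\<close>

lemma purt_sq_error_le:
  assumes x: "\<And>i. i \<in> {1..n} \<Longrightarrow> x i \<in> {0<..1}" and z: "z \<in> {0<..1}"
    and y: "\<And>i. i \<in> {1..n} \<Longrightarrow> y i = s (x i) + e i"
    and lip: "C-lipschitz_on {0..1} s" and S: "\<And>t. t \<in> {0..1} \<Longrightarrow> \<bar>s t\<bar> \<le> S"
  shows "(purt n k u x y z - s z)\<^sup>2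
    \<le> 2 * C\<^sup>2 * enn2real (spread k u z) + 2 * (\<Sum>i=1..n. mate_weight n k u x z i * e i)\<^sup>2
      + S\<^sup>2 / (real (card (cell_mates n k u x z)) + 1)"
proof -
  let ?S = "cell_mates n k u x z" and ?m = "real (card (cell_mates n k u x z))"
  define r where "r = C * sqrt (enn2real (spread k u z))"
  define b where "b = (\<Sum>i\<in>?S. s (x i) - s z) / ?m"
  define g where "g = (\<Sum>i=1..n. mate_weight n k u x z i * e i)"
  have C: "0 \<le> C" using lip by (rule lipschitz_on_nonneg)
  have sub: "?S \<subseteq> {1..n}" by (auto simp: cell_mates_def)
  have r2: "r\<^sup>2 = C\<^sup>2 * enn2real (spread k u z)" by (simp add: r_def power_mult_distrib)
  have purt: "purt n k u x y z = (\<Sum>i\<in>?S. y i) / ?m"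
    using x z by (rule purt_eq_mean_of_cell_mates)
  have g: "g = (\<Sum>i\<in>?S. e i) / ?m"
  proof -
    have "g = (\<Sum>i\<in>?S. e i / ?m)"
      unfolding g_def using sub by (intro sum.mono_neutral_cong_right) (auto simp: mate_weight_def)
    then show ?thesis by (simp add: sum_divide_distrib)
  qed
  show ?thesis
  proof (cases "?S = {}")
    case True
    have "(purt n k u x y z - s z)\<^sup>2 = \<bar>s z\<bar>\<^sup>2" using True purt by simp
    also have "\<dots> \<le> S\<^sup>2" using S[of z] z by (intro power_mono) auto
    finally show ?thesis using True by (simp add: add_increasing)
  next
    case False
    then have m: "?m > 0" by (simp add: card_gt_0_iff)
    have "purt n k u x y z - s z = (\<Sum>i\<in>?S. (s (x i) - s z) + e i) / ?m"
    proof -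
      have "(\<Sum>i\<in>?S. y i) = (\<Sum>i\<in>?S. ((s (x i) - s z) + e i) + s z)"
        using sub y by (intro sum.cong) auto
      then have "(\<Sum>i\<in>?S. y i) = (\<Sum>i\<in>?S. (s (x i) - s z) + e i) + ?m * s z"
        by (simp only: sum.distrib sum_constant)
      then show ?thesis using m False unfolding purt by (simp add: add_divide_distrib)
    qed
    also have "\<dots> = b + g" unfolding b_def g by (simp only: sum.distrib add_divide_distrib)
    finally have bg: "purt n k u x y z - s z = b + g" .
    have dev: "\<bar>s (x i) - s z\<bar> \<le> r" if "i \<in> ?S" for i
    proof -
      have i: "x i \<in> {0..1}" "z \<in> {0..1}" "splits_below k u (x i) = splits_below k u z"
        using that x[of i] z by (auto simp: cell_mates_def)
      have "(x i - z)\<^sup>2 \<le> enn2real (spread k u z)"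
        using enn2real_mono[OF square_dist_le_spread[OF i]] spread_finite[OF i(2)] by simp
      then have "\<bar>x i - z\<bar> \<le> sqrt (enn2real (spread k u z))"
        using real_le_rsqrt by (metis power2_abs)
      then have "C * \<bar>x i - z\<bar> \<le> r" unfolding r_def using C by (rule mult_left_mono)
      moreover have "\<bar>s (x i) - s z\<bar> \<le> C * \<bar>x i - z\<bar>"
        using lipschitz_onD[OF lip i(1,2)] by (simp add: dist_real_def)
      ultimately show ?thesis by simp
    qed
    have "\<bar>b\<bar> \<le> r"
    proof -
      have "\<bar>\<Sum>i\<in>?S. s (x i) - s z\<bar> \<le> (\<Sum>i\<in>?S. \<bar>s (x i) - s z\<bar>)" by (rule sum_abs)
      also have "\<dots> \<le> ?m * r" using dev by (rule sum_bounded_above)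
      finally show ?thesis using m by (simp add: b_def field_simps)
    qed
    then have "b\<^sup>2 \<le> r\<^sup>2" using power_mono[of "\<bar>b\<bar>" r 2] by simp
    have "(b + g)\<^sup>2 \<le> 2 * b\<^sup>2 + 2 * g\<^sup>2"
      using zero_le_power2[of "b - g"] by (simp add: power2_eq_square algebra_simps)
    also have "\<dots> \<le> 2 * r\<^sup>2 + 2 * g\<^sup>2" using \<open>b\<^sup>2 \<le> r\<^sup>2\<close> by simp
    also have "\<dots> \<le> 2 * r\<^sup>2 + 2 * g\<^sup>2 + S\<^sup>2 / (?m + 1)" by simp
    finally show ?thesis unfolding bg r2 g_def by (simp add: mult.assoc)
  qed
qed

section \<open>Exchangeability and the variance term\<close>

context purt_model
begin

abbreviation V :: "source \<Rightarrow> 'a \<Rightarrow> real" where "V \<equiv> case_source X \<epsilon> U Z"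
abbreviation sources :: "source set" where
  "sources \<equiv> Design ` {1..n} \<union> Noise ` {1..n} \<union> Split ` {1..k} \<union> {New}"
abbreviation points :: "source set" where "points \<equiv> insert New (Design ` {1..n})"
abbreviation cell_index :: "'a \<Rightarrow> real \<Rightarrow> nat" where
  "cell_index \<omega> \<equiv> splits_below k (\<lambda>j. U j \<omega>)"
abbreviation mates :: "'a \<Rightarrow> nat set" where
  "mates \<omega> \<equiv> cell_mates n k (\<lambda>j. U j \<omega>) (\<lambda>i. X i \<omega>) (Z \<omega>)"
abbreviation weight :: "'a \<Rightarrow> nat \<Rightarrow> real" where
  "weight \<omega> \<equiv> mate_weight n k (\<lambda>j. U j \<omega>) (\<lambda>i. X i \<omega>) (Z \<omega>)"

lemma measurable_source: "a \<in> sources \<Longrightarrow> V a \<in> borel_measurable P"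
  using independent unfolding indep_vars_def2 by blast

lemma measurable_X [measurable]: "i \<in> {1..n} \<Longrightarrow> X i \<in> borel_measurable P"
  using measurable_source[of "Design i"] by simp

lemma measurable_noise [measurable]: "i \<in> {1..n} \<Longrightarrow> \<epsilon> i \<in> borel_measurable P"
  using measurable_source[of "Noise i"] by simp

lemma measurable_U [measurable]: "j \<in> {1..k} \<Longrightarrow> U j \<in> borel_measurable P"
  using measurable_source[of "Split j"] by simp

lemma measurable_Z [measurable]: "Z \<in> borel_measurable P"
  using measurable_source[of New] by simp

lemma point_law:
  assumes "a \<in> points"
  shows "distr P borel (V a) = density lborel (\<lambda>x. ennreal (\<mu> x * indicator {0..1} x))"
proof -
  have "distributed P lborel (V a) (\<lambda>x. ennreal (\<mu> x * indicator {0..1} x))"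
    using assms X_density Z_density by auto
  then have "distr P lborel (V a) = density lborel (\<lambda>x. ennreal (\<mu> x * indicator {0..1} x))"
    by (simp add: distributed_def)
  moreover have "distr P borel (V a) = distr P lborel (V a)" by (intro distr_cong) auto
  ultimately show ?thesis by simp
qed

lemma joint_law:
  "distr P (\<Pi>\<^sub>M a\<in>sources. borel) (\<lambda>\<omega>. \<lambda>a\<in>sources. V a \<omega>) = (\<Pi>\<^sub>M a\<in>sources. distr P borel (V a))"
  using independent by (subst (asm) indep_vars_iff_distr_eq_PiM') (auto intro: measurable_source)

text \<open>
  The sources are independent, and the design points and the new point share one law, hence the joint law
  of all sources is invariant under swapping the new point with another point. The swap permutes the points, so it leaves the
  counted set unchanged up to renaming.
\<close>

lemma expectation_inverse_count_swap:
  assumes "b \<in> points"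
  shows "(\<integral>\<omega>. 1 / real (card {a\<in>points. cell_index \<omega> (V a \<omega>) = cell_index \<omega> (Z \<omega>)}) \<partial>P)
    = (\<integral>\<omega>. 1 / real (card {a\<in>points. cell_index \<omega> (V a \<omega>) = cell_index \<omega> (V b \<omega>)}) \<partial>P)"
proof -
  define \<pi> where "\<pi> = Transposition.transpose New b"
  define c where "c w = splits_below k (\<lambda>j. w (Split j))" for w :: "source \<Rightarrow> real"
  define g where "g w = 1 / real (card {a\<in>points. c w (w a) = c w (w New)})" for w :: "source \<Rightarrow> real"
  define D where "D = (\<Pi>\<^sub>M a\<in>sources. distr P borel (V a))"
  define B where "B = (\<Pi>\<^sub>M a\<in>sources. (borel :: real measure))"
  have \<pi>_points: "\<pi> permutes points"
    unfolding \<pi>_def using assms by (intro permutes_swap_id) auto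
  then have \<pi>: "\<pi> permutes sources" by (rule permutes_subset) auto
  have law: "distr P borel (V (\<pi> a)) = distr P borel (V a)" for a
    using point_law[of New] point_law[of b] assms by (auto simp: \<pi>_def Transposition.transpose_def)
  have sets_D: "sets D = sets B" unfolding D_def B_def by (intro sets_PiM_cong) auto
  have g: "g \<in> borel_measurable B"
  proof -
    have [measurable]: "Measurable.pred B (\<lambda>w. c w (w a) = c w (w New))" if "a \<in> points" for a
      unfolding c_def B_def
      using that by (intro measurable_same_cell measurable_component_singleton) auto
    show ?thesis unfolding g_def by (subst real_card_filter) measurable
  qed
  have V_meas: "(\<lambda>\<omega>. \<lambda>a\<in>sources. V a \<omega>) \<in> measurable P B"
    unfolding B_def by (intro measurable_restrict measurable_source)
  have law_V: "distr P B (\<lambda>\<omega>. \<lambda>a\<in>sources. V a \<omega>) = D"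
    unfolding B_def D_def by (rule joint_law)
  have \<pi>_meas: "(\<lambda>w. \<lambda>a\<in>sources. w (\<pi> a)) \<in> measurable B B"
    unfolding B_def
    by (intro measurable_restrict measurable_component_singleton)
       (simp only: permutes_in_image[OF \<pi>])
  have swap: "distr D B (\<lambda>w. \<lambda>a\<in>sources. w (\<pi> a)) = D"
  proof -
    have "distr D (\<Pi>\<^sub>M a\<in>sources. distr P borel (V (\<pi> a))) (\<lambda>w. \<lambda>a\<in>sources. w (\<pi> a))
        = (\<Pi>\<^sub>M a\<in>sources. distr P borel (V (\<pi> a)))"
      unfolding D_def
      by (intro distr_PiM_reindex prob_space_distr measurable_source)
         (use \<pi> in \<open>auto simp only: permutes_inj_on permutes_in_image Pi_iff\<close>)
    then show ?thesis
      unfolding law D_def[symmetric] by (subst distr_cong[OF refl sets_D[symmetric] refl])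
  qed
  have g_eq: "g (\<lambda>a\<in>sources. W a)
      = 1 / real (card {a\<in>points. cell_index \<omega> (W a) = cell_index \<omega> (W New)})"
    if "\<And>j. W (Split j) = U j \<omega>" for W \<omega>
  proof -
    have "c (\<lambda>a\<in>sources. W a) = cell_index \<omega>"
      unfolding c_def using that by (intro ext splits_below_cong) auto
    then have "{a\<in>points. c (\<lambda>a\<in>sources. W a) ((\<lambda>a\<in>sources. W a) a)
          = c (\<lambda>a\<in>sources. W a) ((\<lambda>a\<in>sources. W a) New)}
        = {a\<in>points. cell_index \<omega> (W a) = cell_index \<omega> (W New)}"
      by auto
    then show ?thesis unfolding g_def by (simp only:)
  qed
  have g_V: "g (\<lambda>a\<in>sources. V a \<omega>)
      = 1 / real (card {a\<in>points. cell_index \<omega> (V a \<omega>) = cell_index \<omega> (Z \<omega>)})" for \<omega>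
    by (subst g_eq) auto
  have g_V\<pi>: "g (\<lambda>a\<in>sources. (\<lambda>a\<in>sources. V a \<omega>) (\<pi> a))
      = 1 / real (card {a\<in>points. cell_index \<omega> (V a \<omega>) = cell_index \<omega> (V b \<omega>)})" for \<omega>
  proof -
    have "(\<lambda>a\<in>sources. (\<lambda>a\<in>sources. V a \<omega>) (\<pi> a)) = (\<lambda>a\<in>sources. V (\<pi> a) \<omega>)"
      using permutes_in_image[OF \<pi>] by (intro restrict_ext) (simp only: restrict_apply' if_True)
    moreover have "V (\<pi> (Split j)) \<omega> = U j \<omega>" for j
      using assms by (auto simp: \<pi>_def Transposition.transpose_def)
    moreover have "\<pi> New = b" by (simp add: \<pi>_def)
    moreover have "card {a\<in>points. cell_index \<omega> (V (\<pi> a) \<omega>) = cell_index \<omega> (V b \<omega>)}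
        = card {a\<in>points. cell_index \<omega> (V a \<omega>) = cell_index \<omega> (V b \<omega>)}"
    proof (rule bij_betw_same_card)
      have "\<pi> ` {a\<in>points. cell_index \<omega> (V (\<pi> a) \<omega>) = cell_index \<omega> (V b \<omega>)}
          = {a\<in>\<pi> ` points. cell_index \<omega> (V a \<omega>) = cell_index \<omega> (V b \<omega>)}" by blast
      then show "bij_betw \<pi> {a\<in>points. cell_index \<omega> (V (\<pi> a) \<omega>) = cell_index \<omega> (V b \<omega>)}
          {a\<in>points. cell_index \<omega> (V a \<omega>) = cell_index \<omega> (V b \<omega>)}"
        using permutes_inj_on[OF \<pi>_points] by (simp only: bij_betw_def permutes_image[OF \<pi>_points])
    qed
    ultimately show ?thesis by (simp only: g_eq)
  qed
  have "(\<integral>\<omega>. g (\<lambda>a\<in>sources. V a \<omega>) \<partial>P) = (\<integral>w. g w \<partial>D)"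
    unfolding law_V[symmetric] by (rule integral_distr[symmetric, OF V_meas g])
  also have "\<dots> = (\<integral>w. g (\<lambda>a\<in>sources. w (\<pi> a)) \<partial>D)"
    by (subst swap[symmetric], rule integral_distr) (use \<pi>_meas g sets_D in \<open>simp_all cong: measurable_cong_sets\<close>)
  also have "\<dots> = (\<integral>\<omega>. g (\<lambda>a\<in>sources. (\<lambda>a\<in>sources. V a \<omega>) (\<pi> a)) \<partial>P)"
    unfolding law_V[symmetric] by (rule integral_distr[OF V_meas]) (rule measurable_compose[OF \<pi>_meas g])
  finally show ?thesis unfolding g_V g_V\<pi> .
qed

lemma measurable_card_mates [measurable]:
  "(\<lambda>\<omega>. real (card (mates \<omega>))) \<in> borel_measurable P"
  by (intro measurable_card_cell_mates) auto

lemma measurable_weight [measurable]: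
  "i \<in> {1..n} \<Longrightarrow> (\<lambda>\<omega>. weight \<omega> i) \<in> borel_measurable P"
  by (intro measurable_mate_weight) auto

lemma integrable_inverse_count: "integrable P (\<lambda>\<omega>. 1 / (real (card (mates \<omega>)) + 1))"
  by (intro integrable_const_bound[where B=1]) auto

text \<open>
  Summing the inverse size of the own cell over all \<open>n + 1\<close> points counts the occupied cells, of
  which there are at most \<open>k + 1\<close>; by exchangeability every point has the same expectation.
\<close>

lemma expectation_inverse_count_le:
  "(\<integral>\<omega>. 1 / (real (card (mates \<omega>)) + 1) \<partial>P) \<le> (real k + 1) / (real n + 1)"
proof -
  let ?count = "\<lambda>b \<omega>. real (card {a\<in>points. cell_index \<omega> (V a \<omega>) = cell_index \<omega> (V b \<omega>)})"
  have New: "?count New \<omega> = real (card (mates \<omega>)) + 1" for \<omega>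
  proof -
    have "{a\<in>points. cell_index \<omega> (V a \<omega>) = cell_index \<omega> (V New \<omega>)} = insert New (Design ` mates \<omega>)"
      by (auto simp: cell_mates_def)
    moreover have "card (Design ` mates \<omega>) = card (mates \<omega>)"
      by (intro card_image) (simp add: inj_on_def)
    moreover have "card (insert New (Design ` mates \<omega>)) = card (Design ` mates \<omega>) + 1"
      by (subst card_insert_disjoint) auto
    ultimately show ?thesis by (simp only: of_nat_add of_nat_1)
  qed
  have eq: "(\<integral>\<omega>. 1 / ?count b \<omega> \<partial>P) = (\<integral>\<omega>. 1 / (real (card (mates \<omega>)) + 1) \<partial>P)"
    if "b \<in> points" for b
    using expectation_inverse_count_swap[OF that] New by simp
  have int: "integrable P (\<lambda>\<omega>. 1 / ?count b \<omega>)" if "b \<in> points" for b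
  proof (intro integrable_const_bound[where B=1] AE_I2)
    fix \<omega>
    show "norm (1 / ?count b \<omega>) \<le> 1"
      by (cases "?count b \<omega> = 0") (auto simp: divide_simps)
    have [measurable]: "Measurable.pred P (\<lambda>\<omega>. cell_index \<omega> (V a \<omega>) = cell_index \<omega> (V b \<omega>))"
      if "a \<in> points" for a
      using that \<open>b \<in> points\<close> by (intro measurable_same_cell measurable_source) auto
    show "(\<lambda>\<omega>. 1 / ?count b \<omega>) \<in> borel_measurable P"
      by (subst real_card_filter) measurable
  qed
  have card_points: "card points = n + 1"
    by (subst card_insert_disjoint) (auto simp: card_image inj_on_def)
  have "(real n + 1) * (\<integral>\<omega>. 1 / (real (card (mates \<omega>)) + 1) \<partial>P) = (\<Sum>b\<in>points. \<integral>\<omega>. 1 / ?count b \<omega> \<partial>P)"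
    using eq card_points by simp
  also have "\<dots> = (\<integral>\<omega>. (\<Sum>b\<in>points. 1 / ?count b \<omega>) \<partial>P)"
    by (rule Bochner_Integration.integral_sum[symmetric]) (rule int)
  also have "\<dots> = (\<integral>\<omega>. real (card ((\<lambda>a. cell_index \<omega> (V a \<omega>)) ` points)) \<partial>P)"
    by (simp only: sum_inverse_card_fibre finite_insert finite_imageI finite_atLeastAtMost)
  also have "\<dots> \<le> (\<integral>\<omega>. real k + 1 \<partial>P)"
  proof (rule integral_mono')
    fix \<omega>
    have "card ((\<lambda>a. cell_index \<omega> (V a \<omega>)) ` points) \<le> card {..k}"
      by (intro card_mono) (auto simp: splits_below_le)
    then show "real (card ((\<lambda>a. cell_index \<omega> (V a \<omega>)) ` points)) \<le> real k + 1" by simp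
  qed auto
  also have "\<dots> = real k + 1" by (simp add: prob_space)
  finally show ?thesis by (simp add: field_simps)
qed

lemma noise_expectation_product:
  assumes "i \<in> {1..n}" "l \<in> {1..n}"
  shows "integrable P (\<lambda>\<omega>. \<epsilon> i \<omega> * \<epsilon> l \<omega>)"
    and "(\<integral>\<omega>. \<epsilon> i \<omega> * \<epsilon> l \<omega> \<partial>P) = (if i = l then \<sigma>\<^sup>2 else 0)"
proof -
  have int: "integrable P (\<epsilon> j)" if "j \<in> {1..n}" for j
    by (rule square_integrable_imp_integrable[OF measurable_noise[OF that] noise_square_integrable[OF that]])
  have diff: "indep_var borel (\<epsilon> i) borel (\<epsilon> l)" if "i \<noteq> l"
  proof -
    have "indep_var (PiM {Noise i} (\<lambda>_. borel)) (\<lambda>\<omega>. restrict (\<lambda>a. V a \<omega>) {Noise i})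
        (PiM {Noise l} (\<lambda>_. borel)) (\<lambda>\<omega>. restrict (\<lambda>a. V a \<omega>) {Noise l})"
      using assms that by (intro indep_var_restrict[OF independent]) auto
    then have "indep_var borel ((\<lambda>v. v (Noise i)) \<circ> (\<lambda>\<omega>. restrict (\<lambda>a. V a \<omega>) {Noise i}))
        borel ((\<lambda>v. v (Noise l)) \<circ> (\<lambda>\<omega>. restrict (\<lambda>a. V a \<omega>) {Noise l}))"
      by (rule indep_var_compose) (auto intro!: measurable_component_singleton)
    then show ?thesis by (simp add: comp_def)
  qed
  show "integrable P (\<lambda>\<omega>. \<epsilon> i \<omega> * \<epsilon> l \<omega>)"
  proof (cases "i = l")
    case True
    then show ?thesis using noise_square_integrable[OF assms(1)] by (simp add: power2_eq_square)
  next
    case False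
    then show ?thesis by (intro indep_var_integrable diff int assms)
  qed
  show "(\<integral>\<omega>. \<epsilon> i \<omega> * \<epsilon> l \<omega> \<partial>P) = (if i = l then \<sigma>\<^sup>2 else 0)"
  proof (cases "i = l")
    case True
    then show ?thesis
      using noise_variance[OF assms(1)] noise_mean[OF assms(1)] by (simp add: power2_eq_square)
  next
    case False
    then show ?thesis
      using indep_var_lebesgue_integral[OF diff[OF False] int[OF assms(1)] int[OF assms(2)]]
        noise_mean[OF assms(1)] by simp
  qed
qed

text \<open>
  The weights depend on design, splits and new point only, and are therefore independent of the noise.
\<close>

lemma weighted_noise_expectation_product:
  assumes i: "i \<in> {1..n}" and l: "l \<in> {1..n}"
  shows "integrable P (\<lambda>\<omega>. (weight \<omega> i * weight \<omega> l) * (\<epsilon> i \<omega> * \<epsilon> l \<omega>))"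
    and "(\<integral>\<omega>. (weight \<omega> i * weight \<omega> l) * (\<epsilon> i \<omega> * \<epsilon> l \<omega>) \<partial>P)
      = (if i = l then \<sigma>\<^sup>2 * (\<integral>\<omega>. (weight \<omega> i)\<^sup>2 \<partial>P) else 0)"
proof -
  define A where "A = Design ` {1..n} \<union> Split ` {1..k} \<union> {New}"
  define h where "h v i = mate_weight n k (\<lambda>j. v (Split j)) (\<lambda>i. v (Design i)) (v New) i" for v i
  have h: "(\<lambda>v. h v i) \<in> borel_measurable (PiM A (\<lambda>_. borel))" if "i \<in> {1..n}" for i
    unfolding h_def using that
    by (intro measurable_mate_weight measurable_component_singleton) (auto simp: A_def)
  have "indep_var (PiM A (\<lambda>_. borel)) (\<lambda>\<omega>. restrict (\<lambda>a. V a \<omega>) A)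
      (PiM (Noise ` {1..n}) (\<lambda>_. borel)) (\<lambda>\<omega>. restrict (\<lambda>a. V a \<omega>) (Noise ` {1..n}))"
    by (intro indep_var_restrict[OF independent]) (auto simp: A_def)
  then have "indep_var borel ((\<lambda>v. h v i * h v l) \<circ> (\<lambda>\<omega>. restrict (\<lambda>a. V a \<omega>) A))
      borel ((\<lambda>v. v (Noise i) * v (Noise l)) \<circ> (\<lambda>\<omega>. restrict (\<lambda>a. V a \<omega>) (Noise ` {1..n})))"
    by (rule indep_var_compose)
       (use i l in \<open>auto intro!: measurable_component_singleton borel_measurable_times h\<close>)
  moreover have "h (restrict (\<lambda>a. V a \<omega>) A) j = weight \<omega> j" for \<omega> j
  proof -
    have "splits_below k (\<lambda>j. restrict (\<lambda>a. V a \<omega>) A (Split j)) = cell_index \<omega>"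
      by (intro ext splits_below_cong) (simp add: A_def)
    then show ?thesis
      unfolding h_def mate_weight_def cell_mates_def by (simp add: A_def cong: conj_cong)
  qed
  ultimately have ind: "indep_var borel (\<lambda>\<omega>. weight \<omega> i * weight \<omega> l) borel (\<lambda>\<omega>. \<epsilon> i \<omega> * \<epsilon> l \<omega>)"
    using i l by (simp add: comp_def)
  have int: "integrable P (\<lambda>\<omega>. weight \<omega> i * weight \<omega> l)"
    using i l
    by (intro integrable_const_bound[where B=1])
       (auto simp: abs_mult mate_weight_nonneg mate_weight_le_1 intro!: mult_le_one)
  note noise = noise_expectation_product[OF i l]
  show "integrable P (\<lambda>\<omega>. (weight \<omega> i * weight \<omega> l) * (\<epsilon> i \<omega> * \<epsilon> l \<omega>))"
    by (rule indep_var_integrable[OF ind int noise(1)])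
  show "(\<integral>\<omega>. (weight \<omega> i * weight \<omega> l) * (\<epsilon> i \<omega> * \<epsilon> l \<omega>) \<partial>P)
      = (if i = l then \<sigma>\<^sup>2 * (\<integral>\<omega>. (weight \<omega> i)\<^sup>2 \<partial>P) else 0)"
    using indep_var_lebesgue_integral[OF ind int noise(1)] noise(2)
    by (auto simp: power2_eq_square)
qed

lemma weighted_noise_second_moment:
  shows "integrable P (\<lambda>\<omega>. (\<Sum>i=1..n. weight \<omega> i * \<epsilon> i \<omega>)\<^sup>2)"
    and "(\<integral>\<omega>. (\<Sum>i=1..n. weight \<omega> i * \<epsilon> i \<omega>)\<^sup>2 \<partial>P) \<le> 2 * \<sigma>\<^sup>2 * ((real k + 1) / (real n + 1))"
proof -
  let ?t = "\<lambda>i l \<omega>. (weight \<omega> i * weight \<omega> l) * (\<epsilon> i \<omega> * \<epsilon> l \<omega>)"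
  have expand: "(\<Sum>i=1..n. weight \<omega> i * \<epsilon> i \<omega>)\<^sup>2 = (\<Sum>i=1..n. \<Sum>l=1..n. ?t i l \<omega>)" for \<omega>
    unfolding power2_eq_square sum_product by (intro sum.cong refl) (simp only: ac_simps)
  have sq_int: "integrable P (\<lambda>\<omega>. (weight \<omega> i)\<^sup>2)" if "i \<in> {1..n}" for i
    using that
    by (intro integrable_const_bound[where B=1])
       (auto simp: mate_weight_nonneg mate_weight_le_1 intro!: power_le_one)
  show "integrable P (\<lambda>\<omega>. (\<Sum>i=1..n. weight \<omega> i * \<epsilon> i \<omega>)\<^sup>2)"
    unfolding expand by (intro Bochner_Integration.integrable_sum weighted_noise_expectation_product)
  have "(\<integral>\<omega>. (\<Sum>i=1..n. weight \<omega> i * \<epsilon> i \<omega>)\<^sup>2 \<partial>P) = (\<Sum>i=1..n. \<integral>\<omega>. (\<Sum>l=1..n. ?t i l \<omega>) \<partial>P)"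
    unfolding expand
    by (intro Bochner_Integration.integral_sum Bochner_Integration.integrable_sum
        weighted_noise_expectation_product(1))
  also have "\<dots> = (\<Sum>i=1..n. \<Sum>l=1..n. \<integral>\<omega>. ?t i l \<omega> \<partial>P)"
    by (intro sum.cong refl Bochner_Integration.integral_sum weighted_noise_expectation_product(1))
  also have "\<dots> = (\<Sum>i=1..n. \<Sum>l=1..n. if i = l then \<sigma>\<^sup>2 * (\<integral>\<omega>. (weight \<omega> i)\<^sup>2 \<partial>P) else 0)"
    by (intro sum.cong refl weighted_noise_expectation_product(2))
  also have "\<dots> = \<sigma>\<^sup>2 * (\<Sum>i=1..n. \<integral>\<omega>. (weight \<omega> i)\<^sup>2 \<partial>P)"
    by (simp add: sum_distrib_left)
  also have "\<dots> = \<sigma>\<^sup>2 * (\<integral>\<omega>. (\<Sum>i=1..n. (weight \<omega> i)\<^sup>2) \<partial>P)"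
    using sq_int by (simp add: Bochner_Integration.integral_sum)
  also have "\<dots> \<le> \<sigma>\<^sup>2 * (\<integral>\<omega>. 2 * (1 / (real (card (mates \<omega>)) + 1)) \<partial>P)"
    using sum_mate_weight_square_le[of n k]
    by (intro mult_left_mono integral_mono Bochner_Integration.integrable_sum sq_int
        integrable_mult_right integrable_inverse_count) auto
  also have "\<dots> \<le> \<sigma>\<^sup>2 * (2 * ((real k + 1) / (real n + 1)))"
    unfolding integral_mult_right_zero
    by (intro mult_left_mono expectation_inverse_count_le) auto
  finally show "(\<integral>\<omega>. (\<Sum>i=1..n. weight \<omega> i * \<epsilon> i \<omega>)\<^sup>2 \<partial>P) \<le> 2 * \<sigma>\<^sup>2 * ((real k + 1) / (real n + 1))"
    by (simp only: mult_ac)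
qed

section \<open>The bias term\<close>

text \<open>
  The uniform law on \<open>[0,1]\<^sup>k\<close> is obtained as a marginal of the joint law of all sources;
  unlike \<open>{1..k}\<close>, their index set is never empty, as the characterization of independence by
  product measures requires.
\<close>

lemma splits_law:
  "distr P (\<Pi>\<^sub>M j\<in>{1..k}. borel) (\<lambda>\<omega>. \<lambda>j\<in>{1..k}. U j \<omega>)
    = (\<Pi>\<^sub>M j\<in>{1..k}. uniform_measure lborel {0..1})"
proof -
  let ?B = "\<Pi>\<^sub>M a\<in>sources. (borel :: real measure)"
  let ?D = "\<Pi>\<^sub>M a\<in>sources. distr P borel (V a)"
  let ?Bk = "\<Pi>\<^sub>M j\<in>{1..k}. (borel :: real measure)"
  let ?Q = "\<Pi>\<^sub>M j\<in>{1..k}. distr P borel (V (Split j))"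
  have "(\<lambda>\<omega>. \<lambda>j\<in>{1..k}. U j \<omega>)
      = (\<lambda>w. \<lambda>j\<in>{1..k}. w (Split j)) \<circ> (\<lambda>\<omega>. \<lambda>a\<in>sources. V a \<omega>)"
    by (intro ext) (auto simp: restrict_def)
  then have "distr P ?Bk (\<lambda>\<omega>. \<lambda>j\<in>{1..k}. U j \<omega>)
      = distr (distr P ?B (\<lambda>\<omega>. \<lambda>a\<in>sources. V a \<omega>)) ?Bk (\<lambda>w. \<lambda>j\<in>{1..k}. w (Split j))"
    by (subst distr_distr)
       (auto intro!: measurable_restrict measurable_source measurable_component_singleton)
  also have "\<dots> = distr ?D ?Bk (\<lambda>w. \<lambda>j\<in>{1..k}. w (Split j))"
    by (simp only: joint_law)
  also have "\<dots> = distr ?D ?Q (\<lambda>w. \<lambda>j\<in>{1..k}. w (Split j))"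
    by (intro distr_cong refl sets_PiM_cong) auto
  also have "\<dots> = ?Q"
    by (rule distr_PiM_reindex)
       (auto simp: inj_on_def intro!: prob_space_distr simp del: source.case intro: measurable_source)
  also have "\<dots> = (\<Pi>\<^sub>M j\<in>{1..k}. uniform_measure lborel {0..1})"
    using U_uniform by (intro PiM_cong) auto
  finally show ?thesis .
qed

lemma nn_integral_spread_fixed_le:
  assumes "z \<in> {0..1}"
  shows "(\<integral>\<^sup>+\<omega>. spread k (\<lambda>j. U j \<omega>) z \<partial>P) \<le> ennreal (4 / ((real k + 1) * (real k + 2)))"
proof -
  let ?Bk = "\<Pi>\<^sub>M j\<in>{1..k}. (borel :: real measure)"
  let ?U = "\<lambda>\<omega>. \<lambda>j\<in>{1..k}. U j \<omega>"
  have "(\<integral>\<^sup>+\<omega>. spread k (\<lambda>j. U j \<omega>) z \<partial>P) = (\<integral>\<^sup>+\<omega>. spread k (?U \<omega>) z \<partial>P)"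
  proof (intro nn_integral_cong)
    fix \<omega>
    have "cell_index \<omega> = splits_below k (?U \<omega>)" by (intro ext splits_below_cong) auto
    then show "spread k (\<lambda>j. U j \<omega>) z = spread k (?U \<omega>) z" unfolding spread_def by (simp only:)
  qed
  also have "\<dots> = (\<integral>\<^sup>+u. spread k u z \<partial>distr P ?Bk ?U)"
    by (intro nn_integral_distr[symmetric] measurable_restrict measurable_spread) auto
  also have "\<dots> \<le> ennreal (4 / ((real k + 1) * (real k + 2)))"
    unfolding splits_law using assms by (rule nn_integral_spread_le)
  finally show ?thesis .
qed

text \<open>
  The new point is independent of the splits, so the bound for a fixed point, which is uniform over
  \<open>[0,1]\<close>, carries over.
\<close>

lemma nn_integral_spread_new_le:
  "(\<integral>\<^sup>+\<omega>. spread k (\<lambda>j. U j \<omega>) (Z \<omega>) \<partial>P) \<le> ennreal (4 / ((real k + 1) * (real k + 2)))"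
proof -
  let ?b = "4 / ((real k + 1) * (real k + 2))"
  define B1 B2 where "B1 = PiM {New} (\<lambda>_. borel :: real measure)"
    and "B2 = PiM (Split ` {1..k}) (\<lambda>_. borel :: real measure)"
  define R1 R2 where "R1 = (\<lambda>\<omega>. restrict (\<lambda>a. V a \<omega>) {New})"
    and "R2 = (\<lambda>\<omega>. restrict (\<lambda>a. V a \<omega>) (Split ` {1..k}))"
  define F where "F p = spread k (\<lambda>j. snd p (Split j)) (fst p New)"
    for p :: "(source \<Rightarrow> real) \<times> (source \<Rightarrow> real)"
  have F_R: "F (v, R2 \<omega>) = spread k (\<lambda>j. U j \<omega>) (v New)" for v \<omega>
  proof -
    have "splits_below k (\<lambda>j. R2 \<omega> (Split j)) = cell_index \<omega>"
      unfolding R2_def by (intro ext splits_below_cong) auto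
    then show ?thesis unfolding F_def spread_def fst_conv snd_conv by (simp only:)
  qed
  have R_new: "R1 \<omega> New = Z \<omega>" for \<omega> by (simp add: R1_def)
  have "indep_var B1 R1 B2 R2"
    unfolding B1_def B2_def R1_def R2_def by (intro indep_var_restrict[OF independent]) auto
  then have R1: "R1 \<in> measurable P B1" and R2: "R2 \<in> measurable P B2"
    and law: "distr P B1 R1 \<Otimes>\<^sub>M distr P B2 R2 = distr P (B1 \<Otimes>\<^sub>M B2) (\<lambda>\<omega>. (R1 \<omega>, R2 \<omega>))"
    unfolding indep_var_distribution_eq by auto
  interpret R2: prob_space "distr P B2 R2" using R2 by (rule prob_space_distr)
  have coord: "(\<lambda>p. fst p New) \<in> borel_measurable (B1 \<Otimes>\<^sub>M B2)"
    "j \<in> {1..k} \<Longrightarrow> (\<lambda>p. snd p (Split j)) \<in> borel_measurable (B1 \<Otimes>\<^sub>M B2)" for j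
    unfolding B1_def B2_def
    by (auto intro!: measurable_compose[OF measurable_fst] measurable_compose[OF measurable_snd]
        measurable_component_singleton)
  have F: "F \<in> borel_measurable (B1 \<Otimes>\<^sub>M B2)"
    unfolding F_def by (intro measurable_spread coord)
  have "(\<integral>\<^sup>+\<omega>. spread k (\<lambda>j. U j \<omega>) (Z \<omega>) \<partial>P) = (\<integral>\<^sup>+\<omega>. F (R1 \<omega>, R2 \<omega>) \<partial>P)"
    by (simp only: F_R R_new)
  also have "\<dots> = (\<integral>\<^sup>+p. F p \<partial>(distr P B1 R1 \<Otimes>\<^sub>M distr P B2 R2))"
    unfolding law by (intro nn_integral_distr[symmetric] measurable_Pair R1 R2) (simp add: F)
  also have "\<dots> = (\<integral>\<^sup>+v. \<integral>\<^sup>+w. F (v, w) \<partial>distr P B2 R2 \<partial>distr P B1 R1)"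
    using F by (intro R2.nn_integral_fst[symmetric]) (simp cong: measurable_cong_sets)
  also have "\<dots> = (\<integral>\<^sup>+v. \<integral>\<^sup>+\<omega>. spread k (\<lambda>j. U j \<omega>) (v New) \<partial>P \<partial>distr P B1 R1)"
  proof (intro nn_integral_cong)
    fix v assume "v \<in> space (distr P B1 R1)"
    then have "(\<lambda>w. F (v, w)) \<in> borel_measurable B2"
      by (intro measurable_compose[OF measurable_Pair1' F]) simp
    then show "(\<integral>\<^sup>+w. F (v, w) \<partial>distr P B2 R2) = (\<integral>\<^sup>+\<omega>. spread k (\<lambda>j. U j \<omega>) (v New) \<partial>P)"
      by (subst nn_integral_distr[OF R2]) (simp_all add: F_R)
  qed
  also have "\<dots> \<le> (\<integral>\<^sup>+v. ennreal ?b \<partial>distr P B1 R1)"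
  proof (intro nn_integral_mono_AE)
    have "{v\<in>space B1. v New \<in> {0..1}} \<in> sets B1" unfolding B1_def by measurable
    then have "AE v in distr P B1 R1. v New \<in> {0..1}"
      using Z_range R_new by (subst AE_distr_iff[OF R1]) (auto intro!: AE_I2)
    then show "AE v in distr P B1 R1. (\<integral>\<^sup>+\<omega>. spread k (\<lambda>j. U j \<omega>) (v New) \<partial>P) \<le> ennreal ?b"
      by eventually_elim (rule nn_integral_spread_fixed_le)
  qed
  also have "\<dots> = ennreal ?b"
    using prob_space.emeasure_space_1[OF prob_space_distr[OF R1]] by simp
  finally show ?thesis .
qed

lemma expectation_spread_le:
  shows "integrable P (\<lambda>\<omega>. enn2real (spread k (\<lambda>j. U j \<omega>) (Z \<omega>)))"
    and "(\<integral>\<omega>. enn2real (spread k (\<lambda>j. U j \<omega>) (Z \<omega>)) \<partial>P) \<le> 4 / ((real k + 1) * (real k + 2))"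
proof -
  let ?B = "\<lambda>\<omega>. spread k (\<lambda>j. U j \<omega>) (Z \<omega>)"
  have [measurable]: "?B \<in> borel_measurable P" by (intro measurable_spread) auto
  have le: "(\<integral>\<^sup>+\<omega>. ennreal (enn2real (?B \<omega>)) \<partial>P) \<le> ennreal (4 / ((real k + 1) * (real k + 2)))"
  proof -
    have "(\<integral>\<^sup>+\<omega>. ennreal (enn2real (?B \<omega>)) \<partial>P) = (\<integral>\<^sup>+\<omega>. ?B \<omega> \<partial>P)"
      using spread_finite[OF Z_range] by (intro nn_integral_cong) (simp add: less_top)
    then show ?thesis using nn_integral_spread_new_le by simp
  qed
  show int: "integrable P (\<lambda>\<omega>. enn2real (?B \<omega>))"
    using le by (intro integrableI_nonneg) (auto simp: le_less_trans[OF _ ennreal_less_top])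
  have "ennreal (\<integral>\<omega>. enn2real (?B \<omega>) \<partial>P) \<le> ennreal (4 / ((real k + 1) * (real k + 2)))"
    using le by (subst nn_integral_eq_integral[symmetric, OF int]) auto
  then show "(\<integral>\<omega>. enn2real (?B \<omega>) \<partial>P) \<le> 4 / ((real k + 1) * (real k + 2))"
    by (subst (asm) ennreal_le_iff) auto
qed

section \<open>The risk bound\<close>

text \<open>
  The origin belongs to no cell when all splits are nonnegative; it is excluded as a null set.
\<close>

lemma AE_point_positive:
  assumes "a \<in> points"
  shows "AE \<omega> in P. V a \<omega> \<in> {0<..1}"
proof -
  have "distributed P lborel (V a) (\<lambda>x. ennreal (\<mu> x * indicator {0..1} x))"
    using assms X_density Z_density by auto
  then have [measurable]: "(\<lambda>x. ennreal (\<mu> x * indicator {0..1} x)) \<in> borel_measurable lborel"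
    by (simp add: distributed_def)
  have "AE x in distr P borel (V a). x \<noteq> 0"
    unfolding point_law[OF assms] using AE_lborel_singleton[of "0::real"] by (subst AE_density) auto
  then have "AE \<omega> in P. V a \<omega> \<noteq> 0"
    using assms by (subst (asm) AE_distr_iff) (auto intro: measurable_source)
  moreover have "V a \<omega> \<in> {0..1}" if "\<omega> \<in> space P" for \<omega>
    using assms that X_range Z_range by auto
  then have "AE \<omega> in P. V a \<omega> \<in> {0..1}" by (intro AE_I2)
  ultimately show ?thesis by eventually_elim auto
qed

text \<open>
  Outside \<open>[0,1]\<close> the function \<open>s\<close> is arbitrary, so it is replaced by its
  composition with the projection onto \<open>[0,1]\<close>.
\<close>

lemma measurable_regression:
  assumes "continuous_on {0..1} s" "f \<in> borel_measurable P" "\<And>\<omega>. \<omega> \<in> space P \<Longrightarrow> f \<omega> \<in> {0..1}"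
  shows "(\<lambda>\<omega>. s (f \<omega>)) \<in> borel_measurable P"
proof -
  let ?p = "\<lambda>x. max 0 (min 1 x) :: real"
  have "continuous_on UNIV (s \<circ> ?p)"
    by (intro continuous_on_compose continuous_intros continuous_on_subset[OF assms(1)]) auto
  then have "(\<lambda>\<omega>. (s \<circ> ?p) (f \<omega>)) \<in> borel_measurable P"
    by (intro measurable_compose[OF assms(2)] borel_measurable_continuous_onI)
  moreover have "(s \<circ> ?p) (f \<omega>) = s (f \<omega>)" if "\<omega> \<in> space P" for \<omega>
    using assms(3)[OF that] by (simp add: min_absorb2 max_absorb2)
  ultimately show ?thesis by (simp cong: measurable_cong)
qed

lemma measurable_order_stat:
  assumes "j \<le> Suc k"
  shows "(\<lambda>\<omega>. order_stat k (\<lambda>j. U j \<omega>) j) \<in> borel_measurable P"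
proof -
  consider "j = 0" | "1 \<le> j" "j \<le> k" | "j = Suc k" using assms by linarith
  then show ?thesis
  proof cases
    case 2
    have "(\<lambda>\<omega>. real (cell_index \<omega> a)) \<in> borel_measurable P" for a
      unfolding splits_below_def by (subst real_card_filter) measurable
    then have "{\<omega>\<in>space P. real j \<le> real (cell_index \<omega> a)} \<in> sets P" for a
      by measurable
    then show ?thesis
      unfolding borel_measurable_iff_less order_stat_less_iff[OF 2] by simp
  qed (simp_all add: order_stat_def nth_append del: upt_Suc)
qed

lemma measurable_purt_sq_error:
  assumes "continuous_on {0..1} s"
  shows "purt_sq_error s n k X Y U Z \<in> borel_measurable P"
proof -
  have [measurable]: "(\<lambda>\<omega>. s (Z \<omega>)) \<in> borel_measurable P"
    using assms Z_range by (intro measurable_regression) auto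
  have [measurable]: "Y i \<in> borel_measurable P" if "i \<in> {1..n}" for i
  proof -
    have [measurable]: "(\<lambda>\<omega>. s (X i \<omega>)) \<in> borel_measurable P"
      using assms X_range that by (intro measurable_regression) auto
    have "(\<lambda>\<omega>. s (X i \<omega>) + \<epsilon> i \<omega>) \<in> borel_measurable P" using that by measurable
    then show ?thesis using response[OF that] by (simp cong: measurable_cong)
  qed
  have cell: "Measurable.pred P (\<lambda>\<omega>. f \<omega> \<in> purt_cell k (\<lambda>j. U j \<omega>) j)"
    if "j \<in> {0..k}" and [measurable]: "f \<in> borel_measurable P" for f j
  proof -
    have [measurable]: "(\<lambda>\<omega>. order_stat k (\<lambda>j. U j \<omega>) j) \<in> borel_measurable P"
      "(\<lambda>\<omega>. order_stat k (\<lambda>j. U j \<omega>) (Suc j)) \<in> borel_measurable P"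
      using that by (auto intro: measurable_order_stat)
    show ?thesis unfolding purt_cell_def greaterThanAtMost_iff by measurable
  qed
  have [measurable]: "Measurable.pred P (\<lambda>\<omega>. X i \<omega> \<in> purt_cell k (\<lambda>j. U j \<omega>) j)"
    "Measurable.pred P (\<lambda>\<omega>. Z \<omega> \<in> purt_cell k (\<lambda>j. U j \<omega>) j)"
    if "j \<in> {0..k}" "i \<in> {1..n}" for i j
    using that by (auto intro: cell)
  have [measurable]: "(\<lambda>\<omega>. cell_mean n k (\<lambda>j. U j \<omega>) (\<lambda>i. X i \<omega>) (\<lambda>i. Y i \<omega>) j) \<in> borel_measurable P"
    if "j \<in> {0..k}" for j
    unfolding cell_mean_def using that
    by (subst real_card_filter, simp, subst sum.inter_filter) measurable
  have [measurable]: "(\<lambda>\<omega>. indicator (purt_cell k (\<lambda>j. U j \<omega>) j) (Z \<omega>) :: real) \<in> borel_measurable P"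
    if "j \<in> {0..k}" for j
    unfolding indicator_def using cell[OF that measurable_Z] by simp
  show ?thesis
    unfolding purt_sq_error_def[abs_def] purt_def by measurable
qed

lemma purt_risk_le:
  assumes lip: "C-lipschitz_on {0..1} s" and S: "\<And>t. t \<in> {0..1} \<Longrightarrow> \<bar>s t\<bar> \<le> S"
  shows "integrable P (purt_sq_error s n k X Y U Z)"
    and "(\<integral>\<omega>. purt_sq_error s n k X Y U Z \<omega> \<partial>P)
      \<le> 8 * C\<^sup>2 / ((real k + 1) * (real k + 2)) + (4 * \<sigma>\<^sup>2 + S\<^sup>2) * ((real k + 1) / (real n + 1))"
proof -
  let ?err = "purt_sq_error s n k X Y U Z"
  let ?b = "\<lambda>\<omega>. 2 * C\<^sup>2 * enn2real (spread k (\<lambda>j. U j \<omega>) (Z \<omega>))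
    + 2 * (\<Sum>i=1..n. weight \<omega> i * \<epsilon> i \<omega>)\<^sup>2 + S\<^sup>2 * (1 / (real (card (mates \<omega>)) + 1))"
  have "AE \<omega> in P. \<forall>a\<in>points. V a \<omega> \<in> {0<..1}"
    by (intro AE_finite_allI AE_point_positive) auto
  then have bound: "AE \<omega> in P. ?err \<omega> \<le> ?b \<omega>"
    using AE_space
  proof eventually_elim
    case (elim \<omega>)
    show ?case
      unfolding purt_sq_error_def
      using purt_sq_error_le[where x="\<lambda>i. X i \<omega>" and y="\<lambda>i. Y i \<omega>" and e="\<lambda>i. \<epsilon> i \<omega>"
          and z="Z \<omega>" and u="\<lambda>j. U j \<omega>" and k=k and n=n, OF _ _ _ lip S] elim response
      by simp
  qed
  note int = expectation_spread_le(1) weighted_noise_second_moment(1) integrable_inverse_count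
  have int_b: "integrable P ?b"
    by (intro Bochner_Integration.integrable_add integrable_mult_right int)
  show int_err: "integrable P ?err"
    by (rule Bochner_Integration.integrable_bound[OF int_b])
       (use bound measurable_purt_sq_error[OF lipschitz_on_continuous_on[OF lip]]
        in \<open>auto simp: purt_sq_error_def\<close>)
  have "(\<integral>\<omega>. ?err \<omega> \<partial>P) \<le> (\<integral>\<omega>. ?b \<omega> \<partial>P)"
    using int_err int_b bound by (rule integral_mono_AE)
  also have "\<dots> = 2 * C\<^sup>2 * (\<integral>\<omega>. enn2real (spread k (\<lambda>j. U j \<omega>) (Z \<omega>)) \<partial>P)
      + 2 * (\<integral>\<omega>. (\<Sum>i=1..n. weight \<omega> i * \<epsilon> i \<omega>)\<^sup>2 \<partial>P)
      + S\<^sup>2 * (\<integral>\<omega>. 1 / (real (card (mates \<omega>)) + 1) \<partial>P)"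
    by (simp only: Bochner_Integration.integral_add Bochner_Integration.integrable_add
        integrable_mult_right integral_mult_right_zero int)
  also have "\<dots> \<le> 2 * C\<^sup>2 * (4 / ((real k + 1) * (real k + 2)))
      + 2 * (2 * \<sigma>\<^sup>2 * ((real k + 1) / (real n + 1))) + S\<^sup>2 * ((real k + 1) / (real n + 1))"
    by (intro add_mono mult_left_mono expectation_spread_le(2) weighted_noise_second_moment(2)
        expectation_inverse_count_le) auto
  finally show "(\<integral>\<omega>. ?err \<omega> \<partial>P)
      \<le> 8 * C\<^sup>2 / ((real k + 1) * (real k + 2)) + (4 * \<sigma>\<^sup>2 + S\<^sup>2) * ((real k + 1) / (real n + 1))"
    by (simp add: algebra_simps)
qed

end

section \<open>Choice of the number of splits\<close>

text \<open>
  Rounding costs only constants: \<open>k + 1\<close> lies between \<open>q / 2\<close> and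
  \<open>2 q\<close>, where the lower bound combines \<open>k + 1 > q - 1\<close> with
  \<open>k + 1 \<ge> 1\<close>.
\<close>

lemma bias_variance_balance:
  fixes q a b :: real
  assumes "1 \<le> q" "\<bar>real k + 1 - q\<bar> < 1" "real n = q ^ 3" "0 \<le> a" "0 \<le> b"
  shows "a / ((real k + 1) * (real k + 2)) + b * ((real k + 1) / (real n + 1)) \<le> (4 * a + 2 * b) / q\<^sup>2"
proof -
  have "q / 2 \<le> real k + 1" "real k + 1 \<le> 2 * q" using assms by linarith+
  have "(q / 2) * (q / 2) \<le> (real k + 1) * (real k + 2)"
    using assms \<open>q / 2 \<le> real k + 1\<close> by (intro mult_mono) auto
  then have "a / ((real k + 1) * (real k + 2)) \<le> a / ((q / 2) * (q / 2))"
    using assms by (intro divide_left_mono mult_pos_pos) auto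
  moreover have "(real k + 1) / (real n + 1) \<le> (2 * q) / q ^ 3"
    using assms \<open>real k + 1 \<le> 2 * q\<close> by (intro frac_le) auto
  then have "b * ((real k + 1) / (real n + 1)) \<le> b * ((2 * q) / q ^ 3)"
    using assms by (intro mult_left_mono) auto
  moreover have "a / ((q / 2) * (q / 2)) + b * ((2 * q) / q ^ 3) = (4 * a + 2 * b) / q\<^sup>2"
    using assms(1) by (simp add: field_simps power2_eq_square power3_eq_cube)
  ultimately show ?thesis by linarith
qed

theorem corollary1:
  fixes P :: "nat \<Rightarrow> 'a measure"
    and s \<mu> :: "real \<Rightarrow> real"
    and \<nu> :: "real measure"
    and \<sigma> M C :: real
    and k :: "nat \<Rightarrow> nat"
    and X Y \<epsilon> U :: "nat \<Rightarrow> nat \<Rightarrow> 'a \<Rightarrow> real"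
    and Z :: "nat \<Rightarrow> 'a \<Rightarrow> real"
  assumes model: "\<And>n. n \<ge> 1 \<Longrightarrow>
      purt_model (P n) s \<mu> \<nu> \<sigma> n (k n) (X n) (Y n) (\<epsilon> n) (U n) (Z n)"
    and density_bounds: "\<And>x. x \<in> {0..1} \<Longrightarrow> 0 < \<mu> x \<and> \<mu> x \<le> M"
    and lipschitz: "C-lipschitz_on {0..1} s"
    and splits: "\<And>n. n \<ge> 1 \<Longrightarrow> \<bar>real (k n) + 1 - real n powr (1/3)\<bar> < 1"
  shows "\<exists>K>0. \<exists>r :: nat \<Rightarrow> real. r \<in> o(\<lambda>n. real n powr (-2/3)) \<and>
    (\<forall>n\<ge>1. integrable (P n) (purt_sq_error s n (k n) (X n) (Y n) (U n) (Z n)) \<and>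
      (\<integral>\<omega>. purt_sq_error s n (k n) (X n) (Y n) (U n) (Z n) \<omega> \<partial>P n)
        \<le> K * real n powr (-2/3) + r n)"
proof -
  define S where "S = \<bar>s 0\<bar> + C"
  \<comment> \<open>The final \<open>1\<close> only keeps \<open>K\<close> positive when \<open>C\<close>, \<open>\<sigma>\<close> and \<open>S\<close> all vanish.\<close>
  define K where "K = 4 * (8 * C\<^sup>2) + 2 * (4 * \<sigma>\<^sup>2 + S\<^sup>2) + 1"
  have C: "0 \<le> C" using lipschitz by (rule lipschitz_on_nonneg)
  have S: "\<bar>s t\<bar> \<le> S" if "t \<in> {0..1}" for t
  proof -
    have "\<bar>s t - s 0\<bar> \<le> C * \<bar>t - 0\<bar>"
      using lipschitz_onD[OF lipschitz that, of 0] by (simp add: dist_real_def)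
    also have "\<dots> \<le> C" using that C by (simp add: mult_left_le)
    finally show ?thesis unfolding S_def by linarith
  qed
  have "K > 0" unfolding K_def by (intro add_nonneg_pos add_nonneg_nonneg) auto
  \<comment> \<open>The bound holds for every \<open>n\<close> without a remainder.\<close>
  moreover have "(\<lambda>_. 0) \<in> o(\<lambda>n. real n powr (-2/3))" by simp
  moreover have "integrable (P n) (purt_sq_error s n (k n) (X n) (Y n) (U n) (Z n)) \<and>
      (\<integral>\<omega>. purt_sq_error s n (k n) (X n) (Y n) (U n) (Z n) \<omega> \<partial>P n) \<le> K * real n powr (-2/3) + 0"
    if n: "n \<ge> 1" for n
  proof
    interpret purt_model "P n" s \<mu> \<nu> \<sigma> n "k n" "X n" "Y n" "\<epsilon> n" "U n" "Z n"
      using n by (rule model)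
    define q where "q = real n powr (1/3)"
    have q: "1 \<le> q" using n unfolding q_def by (intro ge_one_powr_ge_zero) auto
    have kq: "\<bar>real (k n) + 1 - q\<bar> < 1" using splits[OF n] by (simp only: q_def)
    have q3: "real n = q ^ 3" using n by (simp add: q_def powr_power)
    have q2: "real n powr (-2/3) = 1 / q\<^sup>2"
      using n by (simp add: q_def powr_power powr_minus_divide[symmetric])
    show "integrable (P n) (purt_sq_error s n (k n) (X n) (Y n) (U n) (Z n))"
      using lipschitz S by (rule purt_risk_le(1))
    have "(\<integral>\<omega>. purt_sq_error s n (k n) (X n) (Y n) (U n) (Z n) \<omega> \<partial>P n)
        \<le> 8 * C\<^sup>2 / ((real (k n) + 1) * (real (k n) + 2)) + (4 * \<sigma>\<^sup>2 + S\<^sup>2) * ((real (k n) + 1) / (real n + 1))"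
      using lipschitz S by (rule purt_risk_le(2))
    also have "\<dots> \<le> (4 * (8 * C\<^sup>2) + 2 * (4 * \<sigma>\<^sup>2 + S\<^sup>2)) / q\<^sup>2"
      using q kq q3 by (rule bias_variance_balance) auto
    also have "\<dots> \<le> K / q\<^sup>2" using q by (intro divide_right_mono) (auto simp: K_def)
    finally show "(\<integral>\<omega>. purt_sq_error s n (k n) (X n) (Y n) (U n) (Z n) \<omega> \<partial>P n)
        \<le> K * real n powr (-2/3) + 0"
      unfolding q2 by simp
  qed
  ultimately show ?thesis by blast
qed

end
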